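(* Let $X$ be a complex Banach space, let $A:\operatorname{dom}(A)\subseteq X\to X$ and $B:\operatorname{dom}(B)\subseteq X\to X$ be closed linear operators with $\rho(B)\neq\emptyset$, and let $Y$ be a Banach space continuously embedded in $X$ such that $\operatorname{dom}(A)\subseteq\operatorname{dom}(B^2)\cap Y$, $B(\operatorname{dom}(A))\subseteq Y\subseteq\operatorname{dom}(B)$, and the operator $G=\begin{bmatrix}-B & I \\ A+B^2 & -B\end{bmatrix}$ with domain $\operatorname{dom}(A)\times Y$ generates a $C_0$-group $\{\mathcal T(t)\}_{t\in\mathbb R}$ on $Y\times X$. Then: (i) $C_{A,B}(\cdot)y\in\mathcal C^1(\mathbb R,X)\cap\mathcal C(\mathbb R,Y)$ for every $y\in Y$, and for all $t\in\mathbb R$, $y\in Y$, $$(C_{A,B}(t)y)'=AS_{A,B}(t)y-2BC_{A,B}(t)y+4BS_{A,B}(t)By+2(S_{A,B}(t)By)';$$ (ii) $C_{A,B}(\cdot)x\in\mathcal C^2(\mathbb R,X)\cap\mathcal C^1(\mathbb R,Y)\cap\mathcal C(\mathbb R,\operatorname{dom}(A))$ for every $x\in\operatorname{dom}(A)$, and for all $t\in\mathbb R$, $x\in\operatorname{dom}(A)$, $$(C_{A,B}(t)x)'=AS_{A,B}(t)x-2BC_{A,B}(t)x+4BS_{A,B}(t)Bx+2C_{A,B}(t)Bx-4S_{A,B}(t)B^2x,$$ $$(C_{A,B}(t)x)''=(A+4B^2)C_{A,B}(t)x-4BC_{A,B}(t)Bx+8BS_{A,B}(t)B^2x-8B^2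S_{A,B}(t)Bx-2BAS_{A,B}(t)x.$$
   Context: Domains of closed operators carry the graph norm. Write $\mathcal T(t)=\begin{bmatrix}T_{11}(t) & T_{12}(t) \\ T_{21}(t) & T_{22}(t)\end{bmatrix}$ in block form with respect to $Y\times X$. The generalized cosine and sine families $C_{A,B}(t)\in\mathcal B(\operatorname{dom}(B),X)$ and $S_{A,B}(t)\in\mathcal B(X)$ are given by $C_{A,B}(t)x=T_{22}(t)x-BT_{12}(t)x+2T_{12}(t)Bx$ for $x\in\operatorname{dom}(B)$ and $S_{A,B}(t)x=T_{12}(t)x$ for $x\in X$. Primes denote derivatives with respect to $t$ (in $X$). *)

theory Defs
  imports "HOL-Analysis.Analysis"
begin

section \<open>Complex Banach spaces\<close>

class complex_normed_vector = real_normed_vector +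
  fixes scaleC :: "complex \<Rightarrow> 'a \<Rightarrow> 'a"  (infixr "*\<^sub>C" 75)
  assumes scaleC_add_right: "c *\<^sub>C (x + y) = c *\<^sub>C x + c *\<^sub>C y"
    and scaleC_add_left: "(c + d) *\<^sub>C x = c *\<^sub>C x + d *\<^sub>C x"
    and scaleC_scaleC: "c *\<^sub>C d *\<^sub>C x = (c * d) *\<^sub>C x"
    and scaleC_of_real: "complex_of_real r *\<^sub>C x = r *\<^sub>R x"
    and norm_scaleC: "norm (c *\<^sub>C x) = cmod c * norm x"

class complex_banach = complex_normed_vector + banach

instantiation prod :: (complex_normed_vector, complex_normed_vector) complex_normed_vector
begin

definition scaleC_prod :: "complex \<Rightarrow> 'a \<times> 'b \<Rightarrow> 'a \<times> 'b"
  where "scaleC_prod c z = (c *\<^sub>C fst z, c *\<^sub>C snd z)"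

instance
proof
  fix c d :: complex and x y :: "'a \<times> 'b" and r :: real
  show "c *\<^sub>C (x + y) = c *\<^sub>C x + c *\<^sub>C y"
    by (simp add: scaleC_prod_def scaleC_add_right)
  show "(c + d) *\<^sub>C x = c *\<^sub>C x + d *\<^sub>C x"
    by (simp add: scaleC_prod_def scaleC_add_left)
  show "c *\<^sub>C d *\<^sub>C x = (c * d) *\<^sub>C x"
    by (simp add: scaleC_prod_def scaleC_scaleC)
  show "complex_of_real r *\<^sub>C x = r *\<^sub>R x"
    by (simp add: scaleC_prod_def scaleC_of_real scaleR_prod_def)
  have "norm (c *\<^sub>C x) = sqrt ((cmod c)\<^sup>2 * ((norm (fst x))\<^sup>2 + (norm (snd x))\<^sup>2))"
    by (simp add: scaleC_prod_def norm_prod_def norm_scaleC power_mult_distrib distrib_left)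
  then show "norm (c *\<^sub>C x) = cmod c * norm x"
    by (simp add: norm_prod_def real_sqrt_mult)
qed

end

instance prod :: (complex_banach, complex_banach) complex_banach ..

definition bounded_clinear :: "('a::complex_normed_vector \<Rightarrow> 'b::complex_normed_vector) \<Rightarrow> bool"
  where "bounded_clinear f \<longleftrightarrow> bounded_linear f \<and> (\<forall>c x. f (c *\<^sub>C x) = c *\<^sub>C f x)"


section \<open>Unbounded operators\<close>

text \<open>An operator is given by its domain \<open>D\<close> together with a total function \<open>f\<close>, whose values
  outside \<open>D\<close> are irrelevant.\<close>

definition closed_operator ::
    "'a::complex_normed_vector set \<Rightarrow> ('a \<Rightarrow> 'b::complex_normed_vector) \<Rightarrow> bool"
  where "closed_operator D f \<longleftrightarrow>
    0 \<in> D \<and> (\<forall>x\<in>D. \<forall>y\<in>D. x + y \<in> D \<and> f (x + y) = f x + f y) \<and>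
    (\<forall>c. \<forall>x\<in>D. c *\<^sub>C x \<in> D \<and> f (c *\<^sub>C x) = c *\<^sub>C f x) \<and>
    closed {(x, f x) | x. x \<in> D}"

definition resolvent_set :: "'a::complex_normed_vector set \<Rightarrow> ('a \<Rightarrow> 'a) \<Rightarrow> complex set"
  where "resolvent_set D f =
    {c. bij_betw (\<lambda>x. c *\<^sub>C x - f x) D UNIV \<and>
        bounded_clinear (inv_into D (\<lambda>x. c *\<^sub>C x - f x))}"

definition dom_square :: "'a set \<Rightarrow> ('a \<Rightarrow> 'a) \<Rightarrow> 'a set"
  where "dom_square D f = {x \<in> D. f x \<in> D}"

definition graph_norm :: "('a::real_normed_vector \<Rightarrow> 'b::real_normed_vector) \<Rightarrow> 'a \<Rightarrow> real"
  where "graph_norm f x = norm x + norm (f x)"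


section \<open>Strongly continuous groups\<close>

definition C0_group :: "(real \<Rightarrow> 'a::complex_banach \<Rightarrow> 'a) \<Rightarrow> bool"
  where "C0_group T \<longleftrightarrow>
    (\<forall>t. bounded_clinear (T t)) \<and> T 0 = id \<and> (\<forall>s t. T (s + t) = T s \<circ> T t) \<and>
    (\<forall>z. continuous_on UNIV (\<lambda>t. T t z))"

definition generates_C0_group ::
    "'a::complex_banach set \<Rightarrow> ('a \<Rightarrow> 'a) \<Rightarrow> (real \<Rightarrow> 'a \<Rightarrow> 'a) \<Rightarrow> bool"
  where "generates_C0_group D G T \<longleftrightarrow> C0_group T \<and>
    (\<forall>z w. ((\<lambda>h. (T h z - z) /\<^sub>R h) \<longlongrightarrow> w) (at 0) \<longleftrightarrow> z \<in> D \<and> w = G z)"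


section \<open>Vector-valued functions of class \<open>C\<^sup>k\<close>\<close>

fun Ck :: "nat \<Rightarrow> (real \<Rightarrow> 'a::real_normed_vector) \<Rightarrow> bool"
  where
    "Ck 0 f \<longleftrightarrow> continuous_on UNIV f"
  | "Ck (Suc k) f \<longleftrightarrow> (\<exists>f'. (\<forall>t. (f has_vector_derivative f' t) (at t)) \<and> Ck k f')"

text \<open>Membership in \<open>C\<^sup>k(\<real>, Y)\<close> of a function with values in \<open>X\<close>, where the space \<open>Y\<close> is
  embedded in \<open>X\<close> by \<open>j\<close>; derivatives and continuity are taken in the norm of \<open>Y\<close>.\<close>

definition Ck_into ::
    "nat \<Rightarrow> ('y::real_normed_vector \<Rightarrow> 'x) \<Rightarrow> (real \<Rightarrow> 'x) \<Rightarrow> bool"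
  where "Ck_into k j f \<longleftrightarrow> (\<exists>g. (\<forall>t. f t = j (g t)) \<and> Ck k g)"

definition continuous_into_dom ::
    "'a::real_normed_vector set \<Rightarrow> ('a \<Rightarrow> 'b::real_normed_vector) \<Rightarrow> (real \<Rightarrow> 'a) \<Rightarrow> bool"
  where "continuous_into_dom D A f \<longleftrightarrow>
    (\<forall>t. f t \<in> D) \<and> (\<forall>t. ((\<lambda>s. graph_norm A (f s - f t)) \<longlongrightarrow> 0) (at t))"


section \<open>The block operator and the generalized cosine and sine families\<close>

text \<open>The continuously embedded space \<open>Y\<close> is a Banach space type \<open>'y\<close> together with an injective
  bounded linear map \<open>j\<close> into \<open>X\<close>; as a subset of \<open>X\<close> it is \<open>range j\<close>.\<close>

definition continuous_embedding ::
    "('y::complex_normed_vector \<Rightarrow> 'x::complex_normed_vector) \<Rightarrow> bool"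
  where "continuous_embedding j \<longleftrightarrow> bounded_clinear j \<and> inj j"

definition block_dom :: "('y \<Rightarrow> 'x) \<Rightarrow> 'x set \<Rightarrow> ('y \<times> 'x) set"
  where "block_dom j domA = {(y, x). j y \<in> domA \<and> x \<in> range j}"

text \<open>On \<open>block_dom j domA\<close> the element \<open>- B (j y) + x\<close> lies in \<open>range j\<close>, provided that \<open>B\<close> maps
  \<open>domA\<close> into \<open>range j\<close>; \<open>inv j\<close> then regards it as an element of \<open>Y\<close>.\<close>

definition block_op ::
    "('y \<Rightarrow> 'x::complex_normed_vector) \<Rightarrow> ('x \<Rightarrow> 'x) \<Rightarrow> ('x \<Rightarrow> 'x) \<Rightarrow> 'y \<times> 'x \<Rightarrow> 'y \<times> 'x"
  where "block_op j A B = (\<lambda>(y, x).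
    (inv j (- B (j y) + x), (A (j y) + B (B (j y))) - B x))"

definition block12 :: "(real \<Rightarrow> 'y::zero \<times> 'x \<Rightarrow> 'y \<times> 'x) \<Rightarrow> real \<Rightarrow> 'x \<Rightarrow> 'y"
  where "block12 T t x = fst (T t (0, x))"

definition block22 :: "(real \<Rightarrow> 'y::zero \<times> 'x \<Rightarrow> 'y \<times> 'x) \<Rightarrow> real \<Rightarrow> 'x \<Rightarrow> 'x"
  where "block22 T t x = snd (T t (0, x))"

definition gen_sine ::
    "('y::complex_normed_vector \<Rightarrow> 'x::complex_normed_vector) \<Rightarrow>
     (real \<Rightarrow> 'y \<times> 'x \<Rightarrow> 'y \<times> 'x) \<Rightarrow> real \<Rightarrow> 'x \<Rightarrow> 'x"
  where "gen_sine j T t x = j (block12 T t x)"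

text \<open>Meaningful for \<open>x\<close> in the domain of \<open>B\<close> only.\<close>

definition gen_cosine ::
    "('y::complex_normed_vector \<Rightarrow> 'x::complex_normed_vector) \<Rightarrow> ('x \<Rightarrow> 'x) \<Rightarrow>
     (real \<Rightarrow> 'y \<times> 'x \<Rightarrow> 'y \<times> 'x) \<Rightarrow> real \<Rightarrow> 'x \<Rightarrow> 'x"
  where "gen_cosine j B T t x =
    block22 T t x - B (j (block12 T t x)) + 2 *\<^sub>R j (block12 T t (B x))"

end

theory Submission
  imports Defs
begin

text \<open>By the closed graph theorem \<open>B\<close> is bounded from \<open>Y\<close> to \<open>X\<close>. Writing
  \<open>(y, B y) = G (0, y) + 2 (0, B y)\<close> one finds that \<open>C(t) y\<close> is the first component of
  \<open>T(t) (y, B y)\<close>. For every mild solution \<open>(u, v) = T(t) z\<close> the component \<open>u\<close> is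
  differentiable in \<open>X\<close> with \<open>u' = v - B u\<close>, and if \<open>z\<close> is in the domain of \<open>G\<close> and
  \<open>(u\<^sub>1, v\<^sub>1) = G (u, v)\<close>, then \<open>A u = v\<^sub>1 + B u\<^sub>1\<close>. For \<open>x\<close> in the domain of \<open>A\<close> the vector
  \<open>(x, B x)\<close> is in the domain of \<open>G\<close>, which gives the remaining regularity; the two formulas
  for the derivatives are then algebra.\<close>

section \<open>Baire category and the closed graph theorem\<close>

lemma Baire_closed_cover:
  fixes M :: "nat \<Rightarrow> 'a::complete_space set"
  assumes "\<And>n. closed (M n)" and "(\<Union>n. M n) = UNIV"
  obtains n x r where "r > 0" and "ball x r \<subseteq> M n"
proof -
  have "\<exists>n. interior (M n) \<noteq> {}"
  proof (rule ccontr)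
    assume "\<not> ?thesis"
    then have "Met_TC.mtopology interior_of \<Union>(range M) = {}"
      using assms(1) complete_UNIV
      by (intro Met_TC.metric_Baire_category_alt)
        auto
    then show False
      using assms(2) by simp
  qed
  then show ?thesis
    using that by (metis equals0I mem_interior)
qed

text \<open>By Baire, the closure of some sublevel set of \<open>norm (f x)\<close> contains a ball.
  Hence every vector has arbitrarily close approximations whose images are controlled by its norm.
  Iterating on the remainders gives a series with summable images, and closedness of the graph
  identifies its sum as \<open>f x\<close>.\<close>

lemma closed_graph_imp_bounded_linear:
  fixes f :: "'a::banach \<Rightarrow> 'b::banach"
  assumes "linear f" and "closed (range (\<lambda>x. (x, f x)))"
  shows "bounded_linear f"
proof -
  interpret linear f by fact
  have "x \<in> (\<Union>n. closure {x. norm (f x) \<le> real n})" for x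
    using real_arch_simple[of "norm (f x)"] closure_subset by fastforce
  then have "(\<Union>n. closure {x. norm (f x) \<le> real n}) = UNIV"
    by blast
  then obtain n x\<^sub>0 r where r: "r > 0" "ball x\<^sub>0 r \<subseteq> closure {x. norm (f x) \<le> real n}"
    using Baire_closed_cover[of "\<lambda>n. closure {x. norm (f x) \<le> real n}"]
    by (metis closed_closure)
  \<comment> \<open>Differences of approximations to \<open>x\<^sub>0 + x\<close> and to
    \<open>x\<^sub>0\<close> move the ball to the origin, at the cost of doubling the bound.\<close>
  have ball: "\<exists>y. norm (x - y) < e \<and> norm (f y) \<le> 2 * real n" if "norm x < r" "e > 0" for x e
  proof -
    have "x\<^sub>0 + x \<in> closure {x. norm (f x) \<le> real n}" "x\<^sub>0 \<in> closure {x. norm (f x) \<le> real n}"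
      using r that by (auto simp: dist_norm intro!: subsetD[OF r(2)])
    then obtain u v where uv: "norm (f u) \<le> real n" "dist u (x\<^sub>0 + x) < e / 2"
        "norm (f v) \<le> real n" "dist v x\<^sub>0 < e / 2"
      using \<open>e > 0\<close> unfolding closure_approachable by (metis half_gt_zero mem_Collect_eq)
    have "x - (u - v) = (v - x\<^sub>0) - (u - (x\<^sub>0 + x))"
      by simp
    then have "norm (x - (u - v)) \<le> norm (v - x\<^sub>0) + norm (u - (x\<^sub>0 + x))"
      by (metis norm_triangle_ineq4)
    moreover have "norm (f (u - v)) \<le> norm (f u) + norm (f v)"
      by (simp add: diff norm_triangle_ineq4)
    ultimately show ?thesis
      using uv by (intro exI[of _ "u - v"]) (auto simp: dist_norm)
  qed
  \<comment> \<open>For nonzero \<open>x\<close>, dividing by \<open>c = 2 * norm x / r\<close>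
    gives norm \<open>r / 2\<close>, inside the ball; scaling back turns the bound
    \<open>2 * n\<close> into \<open>c * 2 * n = K * norm x\<close>.\<close>
  define K where "K = 4 * real n / r"
  have K: "K \<ge> 0"
    using r by (simp add: K_def)
  have approx: "\<exists>y. norm (x - y) < e \<and> norm (f y) \<le> K * norm x" if "e > 0" for x e
  proof (cases "x = 0")
    case True
    then show ?thesis
      using that by (intro exI[of _ 0]) (simp add: zero)
  next
    case False
    define c where "c = 2 * norm x / r"
    have c: "c > 0"
      using False r by (simp add: c_def)
    have "norm (x /\<^sub>R c) < r"
      using False r by (simp add: c_def field_simps)
    from ball[OF this, of "e / c"] obtain y where y: "norm (x /\<^sub>R c - y) < e / c"
        "norm (f y) \<le> 2 * real n"
      using divide_pos_pos[OF \<open>e > 0\<close> c] by blast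
    have "x - c *\<^sub>R y = c *\<^sub>R (x /\<^sub>R c - y)"
      using c by (simp add: scaleR_diff_right)
    then have "norm (x - c *\<^sub>R y) = c * norm (x /\<^sub>R c - y)"
      using c by (simp only: norm_scaleR abs_of_pos)
    then have "norm (x - c *\<^sub>R y) < e"
      using y(1) c by (simp only: pos_less_divide_eq mult.commute)
    moreover have "norm (f (c *\<^sub>R y)) \<le> c * (2 * real n)"
      using y(2) c by (simp add: scale)
    ultimately show ?thesis
      by (intro exI[of _ "c *\<^sub>R y"]) (simp add: c_def K_def mult_ac)
  qed
  have "norm (f x) \<le> norm x * (2 * K)" for x
  proof (cases "x = 0")
    case True
    then show ?thesis by (simp add: zero)
  next
    case False
    \<comment> \<open>\<open>g k\<close> approximates the \<open>k\<close>-th remainder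
      \<open>R k\<close>. The prescribed errors halve at each step, so both the remainders and the
      images \<open>f (g k (R k))\<close> decay geometrically.\<close>
    define g where "g k z = (SOME y. norm (z - y) < norm x * (1 / 2) ^ Suc k \<and> norm (f y) \<le> K * norm z)"
      for k z
    have g: "norm (z - g k z) < norm x * (1 / 2) ^ Suc k \<and> norm (f (g k z)) \<le> K * norm z" for k z
      unfolding g_def by (rule someI_ex, rule approx) (use False in simp)
    define R where "R = rec_nat x (\<lambda>k z. z - g k z)"
    have R0: "R 0 = x" and RS: "R (Suc k) = R k - g k (R k)" for k
      by (simp_all add: R_def)
    have R: "norm (R k) \<le> norm x * (1 / 2) ^ k" for k
    proof (cases k)
      case (Suc i)
      show ?thesis
        unfolding Suc RS using g less_imp_le by blast
    qed (simp add: R0)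
    have fg: "norm (f (g k (R k))) \<le> K * norm x * (1 / 2) ^ k" for k
      using g[of "R k" k] mult_left_mono[OF R[of k] K] by (simp add: mult.assoc)
    have sum: "(\<Sum>i<k. g i (R i)) = x - R k" for k
      by (induction k) (auto simp: R0 RS)
    have geo: "(\<lambda>k. K * norm x * (1 / 2) ^ k) sums (K * norm x * 2)"
      using sums_mult[OF geometric_sums[of "1 / 2 :: real"], of "K * norm x"] by simp
    have summ: "summable (\<lambda>k. f (g k (R k)))"
      by (rule summable_comparison_test'[OF sums_summable[OF geo], of 0]) (rule fg)
    have "R \<longlonglongrightarrow> 0"
      by (rule Lim_null_comparison[OF always_eventually[OF allI[OF R]]])
        (intro tendsto_mult_right_zero LIMSEQ_realpow_zero, auto)
    then have "(\<lambda>k. x - R k) \<longlonglongrightarrow> x"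
      using tendsto_diff[OF tendsto_const, of R 0 sequentially x] by simp
    moreover have "(\<lambda>k. f (x - R k)) \<longlonglongrightarrow> (\<Sum>k. f (g k (R k)))"
      unfolding sum[symmetric] Real_Vector_Spaces.linear_sum[OF assms(1)]
      by (rule summable_LIMSEQ[OF summ])
    ultimately have "(\<lambda>k. (x - R k, f (x - R k))) \<longlonglongrightarrow> (x, \<Sum>k. f (g k (R k)))"
      by (rule tendsto_Pair)
    from closed_sequentially[OF assms(2) rangeI this]
    have "(x, \<Sum>k. f (g k (R k))) \<in> range (\<lambda>x. (x, f x))" .
    then have "f x = (\<Sum>k. f (g k (R k)))"
      by auto
    also have "norm \<dots> \<le> (\<Sum>k. K * norm x * (1 / 2) ^ k)"
      by (rule norm_suminf_le[OF fg sums_summable[OF geo]])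
    also have "\<dots> = norm x * (2 * K)"
      using sums_unique[OF geo] by (simp only: mult_ac)
    finally show ?thesis .
  qed
  then show ?thesis
    by (intro bounded_linear_intro[where K = "2 * K"] add scale)
qed

section \<open>Vector-valued calculus on the line\<close>

lemma continuous_imp_antiderivative:
  fixes f :: "real \<Rightarrow> 'a::banach"
  assumes "continuous_on UNIV f"
  obtains F where "F 0 = 0" and "\<And>t. (F has_vector_derivative f t) (at t)"
proof -
  define F where "F t = (if t \<ge> 0 then integral {0..t} f else - integral {t..0} f)" for t
  have cont: "continuous_on S f" for S
    using assms continuous_on_subset by blast
  have int: "f integrable_on {a..b}" for a b
    by (intro integrable_continuous_real cont)
  have F: "F s = integral {a..s} f - integral {a..0} f" if "a \<le> s" "a \<le> 0" for a s
    using that Henstock_Kurzweil_Integration.integral_combine[OF _ _ int, of a 0 s]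
      Henstock_Kurzweil_Integration.integral_combine[OF _ _ int, of a s 0]
    by (auto simp: F_def algebra_simps)
  have "(F has_vector_derivative f t) (at t)" for t
  proof -
    \<comment> \<open>Both \<open>t\<close> and 0 are interior to the interval from
      \<open>-n\<close> to \<open>n\<close>, on which \<open>F\<close> differs from the integral
      based at \<open>-n\<close> by a constant; this treats both signs of \<open>t\<close> at
      once.\<close>
    define n where "n = \<bar>t\<bar> + 1"
    have t: "t \<in> {-n<..<n}" and "n > 0"
      by (auto simp: n_def)
    have "((\<lambda>u. integral {-n..u} f) has_vector_derivative f t) (at t within {-n..n})"
      using t by (intro integral_has_vector_derivative cont) auto
    then have "((\<lambda>u. integral {-n..u} f - integral {-n..0} f) has_vector_derivative f t)
        (at t within {-n<..<n})"
      using has_vector_derivative_diff_const has_vector_derivative_within_subset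
      by (metis greaterThanLessThan_subseteq_atLeastAtMost_iff order_refl)
    then have "((\<lambda>u. integral {-n..u} f - integral {-n..0} f) has_vector_derivative f t) (at t)"
      using t by (simp add: at_within_open[OF t])
    then show ?thesis
      by (rule has_vector_derivative_transform_within_open[OF _ open_greaterThanLessThan t])
        (use F[of "-n"] \<open>n > 0\<close> in auto)
  qed
  moreover have "F 0 = 0"
    by (simp add: F_def)
  ultimately show ?thesis
    using that by blast
qed

text \<open>Links derivatives to the difference quotients by which \<open>generates_C0_group\<close>
  describes the generator.\<close>

lemma has_vector_derivative_iff_quotient:
  "(f has_vector_derivative D) (at x) \<longleftrightarrow> ((\<lambda>h. (f (x + h) - f x) /\<^sub>R h) \<longlongrightarrow> D) (at 0)"
proof -
  have "(f has_vector_derivative D) (at x)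
      \<longleftrightarrow> ((\<lambda>h. norm (f (x + h) - f x - h *\<^sub>R D) / norm h) \<longlongrightarrow> 0) (at 0)"
    by (simp add: has_vector_derivative_def has_derivative_at bounded_linear_scaleR_left)
  also have "\<dots> \<longleftrightarrow> ((\<lambda>h. norm ((f (x + h) - f x) /\<^sub>R h - D)) \<longlongrightarrow> 0) (at 0)"
  proof (rule filterlim_cong[OF refl refl])
    have "norm (f (x + h) - f x - h *\<^sub>R D) / norm h = norm ((f (x + h) - f x) /\<^sub>R h - D)"
      if "h \<noteq> 0" for h
    proof -
      have "(f (x + h) - f x) /\<^sub>R h - D = (f (x + h) - f x - h *\<^sub>R D) /\<^sub>R h"
        using that by (simp add: scaleR_diff_right)
      then show ?thesis
        by (simp add: divide_inverse mult.commute)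
    qed
    then show "\<forall>\<^sub>F h in at 0. norm (f (x + h) - f x - h *\<^sub>R D) / norm h
        = norm ((f (x + h) - f x) /\<^sub>R h - D)"
      by (auto simp: eventually_at_filter)
  qed
  also have "\<dots> \<longleftrightarrow> ((\<lambda>h. (f (x + h) - f x) /\<^sub>R h) \<longlongrightarrow> D) (at 0)"
    by (simp add: tendsto_norm_zero_iff flip: Lim_null)
  finally show ?thesis .
qed

section \<open>Orbits and integrated orbits of a group\<close>

text \<open>By the group law the quotient of the orbit at \<open>t\<close> is both
  \<open>T t\<close> applied to the quotient at 0 and the quotient that tests whether
  \<open>T t z\<close> lies in the domain.\<close>

lemma generates_C0_group_orbit:
  assumes "generates_C0_group D G T" and "z \<in> D"
  shows "T t z \<in> D" and "G (T t z) = T t (G z)"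
    and "((\<lambda>s. T s z) has_vector_derivative T t (G z)) (at t)"
proof -
  have T: "bounded_linear (T t)" "T (s + t) = T s \<circ> T t" for s t
    using assms(1) by (auto simp: generates_C0_group_def C0_group_def bounded_clinear_def)
  have gen: "((\<lambda>h. (T h z - z) /\<^sub>R h) \<longlongrightarrow> w) (at 0) \<longleftrightarrow> z \<in> D \<and> w = G z" for z w
    using assms(1) by (auto simp: generates_C0_group_def)
  have "((\<lambda>h. T t ((T h z - z) /\<^sub>R h)) \<longlongrightarrow> T t (G z)) (at 0)"
    using gen assms(2) by (intro bounded_linear.tendsto[OF T(1)]) auto
  moreover have "T t ((T h z - z) /\<^sub>R h) = (T (t + h) z - T t z) /\<^sub>R h" for h
    by (simp add: T(2) linear_simps[OF T(1)])
  ultimately have lim: "((\<lambda>h. (T (t + h) z - T t z) /\<^sub>R h) \<longlongrightarrow> T t (G z)) (at 0)"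
    by simp
  have "T h (T t z) = T (t + h) z" for h
    by (metis T(2) add.commute comp_apply)
  with lim have "T t z \<in> D \<and> T t (G z) = G (T t z)"
    by (simp flip: gen)
  then show "T t z \<in> D" and "G (T t z) = T t (G z)"
    by auto
  show "((\<lambda>s. T s z) has_vector_derivative T t (G z)) (at t)"
    using lim by (simp add: has_vector_derivative_iff_quotient)
qed

text \<open>Integration brings the orbit of an arbitrary \<open>z\<close> into the domain: since
  \<open>T h (F t) = F (t + h) - F h\<close>, the generator quotient at \<open>F t\<close> is the
  quotient of \<open>F\<close> at \<open>t\<close> minus that at 0.\<close>

lemma generates_C0_group_antiderivative:
  assumes "generates_C0_group D G T" and F: "F 0 = 0"
    and F': "\<And>t. (F has_vector_derivative T t z) (at t)"
  shows "F t \<in> D" and "G (F t) = T t z - z"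
proof -
  have T: "bounded_linear (T t)" "T 0 = id" "T (s + t) = T s \<circ> T t" for s t
    using assms(1) by (auto simp: generates_C0_group_def C0_group_def bounded_clinear_def)
  have gen: "((\<lambda>h. (T h z - z) /\<^sub>R h) \<longlongrightarrow> w) (at 0) \<longleftrightarrow> z \<in> D \<and> w = G z" for z w
    using assms(1) by (auto simp: generates_C0_group_def)
  have TF: "T h (F t) = F (t + h) - F h" for h t
  proof -
    \<comment> \<open>The difference is constant in \<open>t\<close>, and \<open>F 0 = 0\<close>
      gives its value \<open>- F h\<close> at 0.\<close>
    have "((\<lambda>t. T h (F t) - F (t + h)) has_vector_derivative 0) (at t)" for t
    proof -
      have "((\<lambda>t. T h (F t)) has_vector_derivative T h (T t z)) (at t)"
        by (rule bounded_linear.has_vector_derivative[OF T(1) F'])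
      moreover have "((\<lambda>t. F (t + h)) has_vector_derivative T (t + h) z) (at t)"
        using F'[of "t + h"] by (simp add: has_vector_derivative_iff_quotient add_ac)
      moreover have "T (t + h) z = T h (T t z)"
        by (metis T(3) add.commute comp_apply)
      ultimately show ?thesis
        using has_vector_derivative_diff by fastforce
    qed
    then obtain c where "T h (F t) - F (t + h) = c" for t
      using has_vector_derivative_zero_constant[of UNIV "\<lambda>t. T h (F t) - F (t + h)"] by auto
    from this[of t] this[of 0] show ?thesis
      by (simp add: F linear_simps[OF T(1)] diff_eq_eq)
  qed
  have "((\<lambda>h. (F (t + h) - F t) /\<^sub>R h - (F (0 + h) - F 0) /\<^sub>R h) \<longlongrightarrow> T t z - T 0 z) (at 0)"
    using F' by (intro tendsto_diff) (simp_all only: has_vector_derivative_iff_quotient)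
  then have "((\<lambda>h. (T h (F t) - F t) /\<^sub>R h) \<longlongrightarrow> T t z - z) (at 0)"
    by (simp add: TF F T(2) algebra_simps)
  then show "F t \<in> D" and "G (F t) = T t z - z"
    by (simp_all add: gen)
qed

lemma closed_operator_simps:
  assumes "closed_operator D f" and "x \<in> D"
  shows "y \<in> D \<Longrightarrow> x + y \<in> D" "y \<in> D \<Longrightarrow> f (x + y) = f x + f y"
    and "r *\<^sub>R x \<in> D" "f (r *\<^sub>R x) = r *\<^sub>R f x"
    and "y \<in> D \<Longrightarrow> x - y \<in> D" "y \<in> D \<Longrightarrow> f (x - y) = f x - f y"
proof -
  have add: "x + y \<in> D" "f (x + y) = f x + f y" if "x \<in> D" "y \<in> D" for x y
    using assms(1) that by (auto simp: closed_operator_def)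
  have scale: "r *\<^sub>R x \<in> D" "f (r *\<^sub>R x) = r *\<^sub>R f x" if "x \<in> D" for x r
    using assms(1) that by (auto simp: closed_operator_def simp flip: scaleC_of_real)
  show "y \<in> D \<Longrightarrow> x + y \<in> D" "y \<in> D \<Longrightarrow> f (x + y) = f x + f y"
    and "r *\<^sub>R x \<in> D" "f (r *\<^sub>R x) = r *\<^sub>R f x"
    using add scale assms(2) by auto
  show "y \<in> D \<Longrightarrow> x - y \<in> D" "y \<in> D \<Longrightarrow> f (x - y) = f x - f y"
    using add[OF assms(2) scale(1), of y "-1"] scale[of y "-1"] by simp_all
qed

section \<open>The block operator and its orbits\<close>

locale block_group =
  fixes j :: "'y::complex_banach \<Rightarrow> 'x::complex_banach"
    and domA domB :: "'x set"
    and A B :: "'x \<Rightarrow> 'x"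
    and T :: "real \<Rightarrow> 'y \<times> 'x \<Rightarrow> 'y \<times> 'x"
  assumes closed_A: "closed_operator domA A"
    and closed_B: "closed_operator domB B"
    and embedding: "continuous_embedding j"
    and domA: "domA \<subseteq> dom_square domB B \<inter> range j"
    and B_domA: "B ` domA \<subseteq> range j"
    and range_j: "range j \<subseteq> domB"
    and generates: "generates_C0_group (block_dom j domA) (block_op j A B) T"
begin

abbreviation "D \<equiv> block_dom j domA"
abbreviation "G \<equiv> block_op j A B"

lemmas A_simps = closed_operator_simps[OF closed_A]
lemmas B_simps = closed_operator_simps[OF closed_B]

lemma j_domB [simp]: "j y \<in> domB"
  using range_j by auto

lemma bounded_linear_j: "bounded_linear j"
  and inj_j: "inj j"
  using embedding by (auto simp: continuous_embedding_def bounded_clinear_def)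

lemmas j_simps = linear_simps[OF bounded_linear_j]

text \<open>As \<open>range j\<close> lies in \<open>domB\<close>, this map is defined on all of Y.
  Its graph is the preimage of the closed graph of \<open>B\<close> under the continuous map sending
  \<open>(y, x)\<close> to \<open>(j y, x)\<close>.\<close>

lemma bounded_linear_B_j: "bounded_linear (\<lambda>y. B (j y))"
proof (rule closed_graph_imp_bounded_linear)
  show "linear (\<lambda>y. B (j y))"
    by (rule linearI) (simp_all add: j_simps B_simps)
  have "closed ((\<lambda>(y, x). (j y, x)) -` {(x, B x) | x. x \<in> domB})"
    using closed_B bounded_linear_j unfolding case_prod_beta
    by (intro closed_vimage continuous_intros linear_continuous_on bounded_linear_compose[OF _ bounded_linear_fst])
      (auto simp: closed_operator_def)
  also have "(\<lambda>(y, x). (j y, x)) -` {(x, B x) | x. x \<in> domB} = range (\<lambda>y. (y, B (j y)))"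
    by auto
  finally show "closed (range (\<lambda>y. (y, B (j y))))" .
qed

lemma bounded_linear_T: "bounded_linear (T t)"
  and continuous_T: "continuous_on S (\<lambda>t. T t z)"
  using generates continuous_on_subset[of UNIV "\<lambda>t. T t z" S]
  by (simp_all add: generates_C0_group_def C0_group_def bounded_clinear_def del: split_paired_All)

lemmas T_simps = linear_simps[OF bounded_linear_T]
lemmas orbit = generates_C0_group_orbit[OF generates]

lemma block_dom_iff: "z \<in> D \<longleftrightarrow> j (fst z) \<in> domA \<and> snd z \<in> range j"
  by (cases z) (auto simp: block_dom_def)

lemma B_j_mem_range: "j y \<in> domA \<Longrightarrow> B (j y) \<in> range j"
  using B_domA by auto

text \<open>Justifies cancelling \<open>inv j\<close> against \<open>j\<close>: on \<open>D\<close>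
  both summands lie in \<open>range j\<close>, the one with \<open>B\<close> because
  \<open>B\<close> maps \<open>domA\<close> there.\<close>

lemma block_op_fst: "z \<in> D \<Longrightarrow> j (fst (G z)) = snd z - B (j (fst z))"
proof -
  assume "z \<in> D"
  then obtain y x where "B (j (fst z)) = j y" "snd z = j x"
    using B_j_mem_range by (meson block_dom_iff imageE)
  then have "snd z - B (j (fst z)) \<in> range j"
    by (metis j_simps(2) rangeI)
  then show ?thesis
    by (simp add: block_op_def case_prod_beta f_inv_into_f)
qed

lemma block_op_snd: "snd (G z) = A (j (fst z)) + B (B (j (fst z))) - B (snd z)"
  by (simp add: block_op_def case_prod_beta)

text \<open>For \<open>z = (u, v)\<close> the second row gives A u as its value plus B v - B^2 u,
  that is plus B(v - B u), and v - B u is the first row. Thus A u is expressed by \<open>G z\<close>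
  and the bounded map of \<open>bounded_linear_B_j\<close>.\<close>

lemma A_fst:
  assumes "z \<in> D"
  shows "A (j (fst z)) = snd (G z) + B (j (fst (G z)))"
  using assms B_j_mem_range range_j
  by (subst block_op_fst) (auto simp: block_op_snd block_dom_iff B_simps subset_iff)

text \<open>The first component of a mild solution is differentiable in \<open>X\<close>, though in general not
  in \<open>Y\<close>: its integrated equation only involves \<open>B\<close>, which is bounded from \<open>Y\<close> to \<open>X\<close>.\<close>

lemma has_vector_derivative_fst_orbit:
  "((\<lambda>t. j (fst (T t z))) has_vector_derivative snd (T t z) - B (j (fst (T t z)))) (at t)"
proof -
  \<comment> \<open>The integrated orbit lies in \<open>D\<close> for every \<open>z\<close>, so the
    first row of \<open>G\<close> applies to \<open>F t\<close>; the resulting identity is then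
    differentiated.\<close>
  obtain F where F: "F 0 = 0" "\<And>t. (F has_vector_derivative T t z) (at t)"
    using continuous_imp_antiderivative[OF continuous_T] by blast
  have "j (fst (T t z)) = snd (F t) - B (j (fst (F t))) + j (fst z)" for t
  proof -
    have "j (fst (T t z)) - j (fst z) = j (fst (G (F t)))"
      by (simp add: generates_C0_group_antiderivative(2)[OF generates F] j_simps)
    also have "\<dots> = snd (F t) - B (j (fst (F t)))"
      by (intro block_op_fst generates_C0_group_antiderivative(1)[OF generates F])
    finally show ?thesis
      by (simp add: algebra_simps)
  qed
  moreover have "((\<lambda>t. snd (F t) - B (j (fst (F t))) + j (fst z)) has_vector_derivative
      snd (T t z) - B (j (fst (T t z)))) (at t)"
    unfolding has_vector_derivative_add_const
    by (intro has_vector_derivative_diff F(2) bounded_linear.has_vector_derivative[OF bounded_linear_snd]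
        bounded_linear.has_vector_derivative[OF bounded_linear_B_j]
        bounded_linear.has_vector_derivative[OF bounded_linear_fst])
  ultimately show ?thesis
    by simp
qed

lemma continuous_fst_orbit: "continuous_on S (\<lambda>t. fst (T t z))"
  and continuous_snd_orbit: "continuous_on S (\<lambda>t. snd (T t z))"
  by (intro continuous_intros continuous_T)+

lemma continuous_derivative_orbit: "continuous_on S (\<lambda>t. snd (T t z) - B (j (fst (T t z))))"
  by (intro continuous_intros continuous_snd_orbit continuous_fst_orbit
      bounded_linear.continuous_on[OF bounded_linear_B_j])

lemma Ck_Suc_0_fst_orbit: "Ck (Suc 0) (\<lambda>t. j (fst (T t z)))"
  using has_vector_derivative_fst_orbit continuous_derivative_orbit by fastforce

section \<open>The cosine family as an orbit component; its derivative on Y\<close>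

lemma Pair_0_mem_block_dom: "(0, j y) \<in> D"
  using closed_A by (simp add: block_dom_iff j_simps closed_operator_def)

lemma block_op_Pair_0: "G (0, j y) = (y, - B (j y))"
proof -
  have "A 0 = 0" "B 0 = 0"
    using A_simps(4)[of 0 0] B_simps(4)[of 0 0] closed_A closed_B
    by (simp_all add: closed_operator_def)
  then show ?thesis
    by (simp add: block_op_def j_simps inv_f_f[OF inj_j])
qed

text \<open>\<open>G\<close> commutes with \<open>T t\<close> on its domain, so the orbit through
  (y, B y) is expressed by the second column of the group, the one that defines both
  families.\<close>

lemma gen_cosine_split:
  "T t (y, B (j y)) = G (T t (0, j y)) + 2 *\<^sub>R T t (0, B (j y))"
proof -
  have "(y, B (j y)) = G (0, j y) + 2 *\<^sub>R (0, B (j y))"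
    by (simp add: block_op_Pair_0 scaleR_2)
  then show ?thesis
    using orbit(2)[OF Pair_0_mem_block_dom] by (simp add: T_simps del: scaleR_Pair)
qed

text \<open>The cosine family is the \<open>Y\<close>-component of the orbit through \<open>(y, B y)\<close>; in this form its
  regularity is that of an orbit.\<close>

lemma gen_cosine_eq: "gen_cosine j B T t (j y) = j (fst (T t (y, B (j y))))"
  unfolding gen_cosine_split
  by (simp add: j_simps block_op_fst[OF orbit(1)[OF Pair_0_mem_block_dom]] gen_cosine_def
      block12_def block22_def)

text \<open>The orbit through (0, x). It identifies the bracket in the next derivative formula as
  the derivative of S(t)By.\<close>

lemma gen_sine_derivative:
  "((\<lambda>t. gen_sine j T t x) has_vector_derivative block22 T t x - B (gen_sine j T t x)) (at t)"
  using has_vector_derivative_fst_orbit[of "(0, x)"]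
  by (simp add: gen_sine_def block12_def block22_def)

lemma gen_sine_domA: "gen_sine j T t (j y) \<in> domA"
  using orbit(1)[OF Pair_0_mem_block_dom, of t y]
  by (simp add: block_dom_iff gen_sine_def block12_def)

lemma gen_cosine_derivative:
  "((\<lambda>t. gen_cosine j B T t (j y)) has_vector_derivative
    A (gen_sine j T t (j y)) - 2 *\<^sub>R B (gen_cosine j B T t (j y))
      + 4 *\<^sub>R B (gen_sine j T t (B (j y)))
      + 2 *\<^sub>R (block22 T t (B (j y)) - B (gen_sine j T t (B (j y))))) (at t)"
proof -
  define w where "w = T t (0, j y)"
  define p where "p = T t (0, B (j y))"
  have w: "w \<in> D"
    unfolding w_def by (rule orbit(1)[OF Pair_0_mem_block_dom])
  \<comment> \<open>Here \<open>x + a\<close> becomes AS(t)y by \<open>A_fst\<close>,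
    \<open>a + 2 *\<^sub>R b\<close> becomes BC(t)y, \<open>b\<close> becomes BS(t)By, and
    \<open>v - b\<close> the derivative of S(t)By.\<close>
  have regroup: "x + 2 *\<^sub>R v - (a + 2 *\<^sub>R b) = (x + a) - 2 *\<^sub>R (a + 2 *\<^sub>R b) + 4 *\<^sub>R b + 2 *\<^sub>R (v - b)"
    for x v a b :: 'x
  proof -
    have "4 *\<^sub>R b = 2 *\<^sub>R b + 2 *\<^sub>R b"
      by (simp flip: scaleR_left_distrib)
    then show ?thesis
      by (simp add: scaleR_2 algebra_simps)
  qed
  have "B (j (fst (G w + 2 *\<^sub>R p))) = B (j (fst (G w))) + 2 *\<^sub>R B (j (fst p))"
    by (simp add: j_simps B_simps)
  then have "snd (G w + 2 *\<^sub>R p) - B (j (fst (G w + 2 *\<^sub>R p)))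
      = A (j (fst w)) - 2 *\<^sub>R B (j (fst (G w + 2 *\<^sub>R p))) + 4 *\<^sub>R B (j (fst p))
        + 2 *\<^sub>R (snd p - B (j (fst p)))"
    using regroup by (simp only: A_fst[OF w] snd_add snd_scaleR)
  then show ?thesis
    using has_vector_derivative_fst_orbit[of "(y, B (j y))" t]
    by (simp add: gen_cosine_eq gen_cosine_split gen_sine_def block12_def block22_def w_def p_def)
qed

section \<open>Higher regularity on the domain of A\<close>

lemma Pair_mem_block_dom: "j y \<in> domA \<Longrightarrow> (y, B (j y)) \<in> D"
  using B_j_mem_range by (simp add: block_dom_iff)

lemma has_vector_derivative_gen_cosine_domA:
  assumes "j y \<in> domA"
  shows "((\<lambda>t. gen_cosine j B T t (j y)) has_vector_derivative
    j (fst (T t (G (y, B (j y)))))) (at t)"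
  unfolding gen_cosine_eq using Pair_mem_block_dom[OF assms]
  by (intro bounded_linear.has_vector_derivative[OF bounded_linear_j]
      bounded_linear.has_vector_derivative[OF bounded_linear_fst] orbit(3))

text \<open>The first derivative is the first component of the orbit through
  \<open>G (y, B (j y))\<close>. Differentiability in X of first components needs no domain
  condition, so it can be differentiated once more.\<close>

lemma vector_derivative_gen_cosine_derivative:
  assumes "j y \<in> domA"
  shows "((\<lambda>s. vector_derivative (\<lambda>r. gen_cosine j B T r (j y)) (at s)) has_vector_derivative
    snd (T t (G (y, B (j y)))) - B (j (fst (T t (G (y, B (j y))))))) (at t)"
  using has_vector_derivative_fst_orbit
  by (simp add: vector_derivative_at[OF has_vector_derivative_gen_cosine_domA[OF assms]])

text \<open>The orbit stays in \<open>D\<close>, and \<open>A_fst\<close> expresses AC(t)x by a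
  continuous orbit. This is what yields continuity in the graph norm of \<open>A\<close>.\<close>

lemma gen_cosine_domA:
  assumes "j y \<in> domA"
  shows "gen_cosine j B T t (j y) \<in> domA"
    and "A (gen_cosine j B T t (j y))
      = snd (T t (G (y, B (j y)))) + B (j (fst (T t (G (y, B (j y))))))"
  using orbit(1,2)[OF Pair_mem_block_dom[OF assms], of t] A_fst[of "T t (y, B (j y))"]
  by (auto simp: gen_cosine_eq block_dom_iff)

lemma continuous_into_domA_gen_cosine:
  assumes "j y \<in> domA"
  shows "continuous_into_dom domA A (\<lambda>t. gen_cosine j B T t (j y))"
proof -
  have "continuous_on UNIV (\<lambda>t. gen_cosine j B T t (j y))"
    unfolding gen_cosine_eq
    by (intro bounded_linear.continuous_on[OF bounded_linear_j] continuous_fst_orbit)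
  moreover have "continuous_on UNIV (\<lambda>t. A (gen_cosine j B T t (j y)))"
    unfolding gen_cosine_domA(2)[OF assms]
    by (intro continuous_intros continuous_snd_orbit continuous_fst_orbit
      bounded_linear.continuous_on[OF bounded_linear_B_j])
  ultimately have "((\<lambda>s. norm (gen_cosine j B T s (j y) - gen_cosine j B T t (j y))
      + norm (A (gen_cosine j B T s (j y)) - A (gen_cosine j B T t (j y)))) \<longlongrightarrow> 0 + 0) (at t)" for t
    by (intro tendsto_add tendsto_norm_zero LIM_zero) (auto simp: continuous_on_def)
  then show ?thesis
    by (simp add: continuous_into_dom_def graph_norm_def A_simps gen_cosine_domA(1)[OF assms])
qed

text \<open>Gives a meaning to the term BAS(t)x. For x in the domain of A, Bx lies in Y, so
  \<open>G (0, j y)\<close> is again in \<open>D\<close>; \<open>A_fst\<close> then writes AS(t)x as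
  a sum of two elements of \<open>range j\<close>.\<close>

lemma A_gen_sine_domB:
  assumes "j y \<in> domA"
  shows "A (gen_sine j T t (j y)) \<in> domB"
proof -
  define w where "w = T t (0, j y)"
  obtain b where "B (j y) = j b"
    using B_j_mem_range[OF assms] by auto
  then have "- B (j y) = j (- b)"
    by (simp add: j_simps)
  then have "G (0, j y) \<in> D"
    using assms by (simp add: block_op_Pair_0 block_dom_iff)
  then have "T t (G (0, j y)) \<in> D"
    by (rule orbit(1))
  then have "G w \<in> D" and "w \<in> D"
    using orbit(1,2)[OF Pair_0_mem_block_dom] by (simp_all add: w_def)
  then have "snd (G w) + B (j (fst (G w))) \<in> domB"
    using B_j_mem_range range_j by (intro B_simps(1)) (auto simp: block_dom_iff)
  then show ?thesis
    using A_fst[OF \<open>w \<in> D\<close>] by (simp add: w_def gen_sine_def block12_def)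
qed

text \<open>By the definition of the cosine family at By, the derivative of S(t)By equals C(t)By -
  2S(t)B^2y.\<close>

lemma gen_cosine_derivative_domA:
  "((\<lambda>t. gen_cosine j B T t (j y)) has_vector_derivative
    A (gen_sine j T t (j y)) - 2 *\<^sub>R B (gen_cosine j B T t (j y))
      + 4 *\<^sub>R B (gen_sine j T t (B (j y))) + 2 *\<^sub>R gen_cosine j B T t (B (j y))
      - 4 *\<^sub>R gen_sine j T t (B (B (j y)))) (at t)"
  using gen_cosine_derivative[of y t]
  by (simp add: gen_cosine_def[of j B T t "B (j y)"] gen_sine_def scaleR_add_right)

text \<open>With (u, v) the orbit through (x, Bx), the second derivative is Au + 2B^2u - 2Bv. The
  two expressions for the first derivative are compared to eliminate v.\<close>

lemma gen_cosine_second_derivative: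
  assumes "j y \<in> domA"
  shows "((\<lambda>s. vector_derivative (\<lambda>r. gen_cosine j B T r (j y)) (at s)) has_vector_derivative
    (A (gen_cosine j B T t (j y)) + 4 *\<^sub>R B (B (gen_cosine j B T t (j y))))
      - 4 *\<^sub>R B (gen_cosine j B T t (B (j y))) + 8 *\<^sub>R B (gen_sine j T t (B (B (j y))))
      - 8 *\<^sub>R B (B (gen_sine j T t (B (j y)))) - 2 *\<^sub>R B (A (gen_sine j T t (j y)))) (at t)"
proof -
  define w where "w = T t (y, B (j y))"
  obtain b where b: "B (j y) = j b"
    using B_j_mem_range[OF assms] by auto
  have w: "w \<in> D"
    unfolding w_def by (rule orbit(1)[OF Pair_mem_block_dom[OF assms]])
  have C: "gen_cosine j B T t (j y) = j (fst w)"
    by (simp add: gen_cosine_eq w_def)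
  \<comment> \<open>These memberships allow \<open>B\<close> to be applied term by term to the
    formula for \<open>snd w\<close>.\<close>
  have dom: "j (fst w) \<in> domB" "B (j (fst w)) \<in> domB" "snd w \<in> domB"
    "B (gen_sine j T t (j b)) \<in> domB" "gen_cosine j B T t (j b) \<in> domB"
    "gen_sine j T t (B (j b)) \<in> domB" "A (gen_sine j T t (j y)) \<in> domB"
    using w domA gen_sine_domA[of t b] A_gen_sine_domB[OF assms] range_j
    by (auto simp: block_dom_iff dom_square_def gen_cosine_eq gen_sine_def subset_iff)
  have "snd w - B (j (fst w)) = A (gen_sine j T t (j y)) - 2 *\<^sub>R B (j (fst w))
      + 4 *\<^sub>R B (gen_sine j T t (j b)) + 2 *\<^sub>R gen_cosine j B T t (j b)
      - 4 *\<^sub>R gen_sine j T t (B (j b))"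
    unfolding w_def b[symmetric]
    by (rule vector_derivative_unique_at[OF has_vector_derivative_fst_orbit
          gen_cosine_derivative_domA[of y t, unfolded gen_cosine_eq[of _ y]]])
  then have "snd w = A (gen_sine j T t (j y)) + 2 *\<^sub>R gen_cosine j B T t (j b)
      + 4 *\<^sub>R B (gen_sine j T t (j b)) - B (j (fst w)) - 4 *\<^sub>R gen_sine j T t (B (j b))"
    by (simp add: diff_eq_eq scaleR_2)
  then have Bv: "B (snd w) = B (A (gen_sine j T t (j y))) + 2 *\<^sub>R B (gen_cosine j B T t (j b))
      + 4 *\<^sub>R B (B (gen_sine j T t (j b))) - B (B (j (fst w)))
      - 4 *\<^sub>R B (gen_sine j T t (B (j b)))"
    using dom by (simp add: B_simps)
  have C'': "snd (G w) - B (j (fst (G w)))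
      = A (j (fst w)) + 2 *\<^sub>R B (B (j (fst w))) - 2 *\<^sub>R B (snd w)"
    using dom by (simp add: block_op_fst[OF w] block_op_snd B_simps scaleR_2)
  \<comment> \<open>Half of the coefficient 4 of B^2C(t)x stands in \<open>C''\<close>; the other
    half comes from -2Bv.\<close>
  have "4 *\<^sub>R v = 2 *\<^sub>R v + 2 *\<^sub>R v" "8 *\<^sub>R v = 4 *\<^sub>R v + 4 *\<^sub>R v" for v :: 'x
    by (simp_all flip: scaleR_left_distrib)
  then have "snd (G w) - B (j (fst (G w)))
      = A (j (fst w)) + 4 *\<^sub>R B (B (j (fst w))) - 4 *\<^sub>R B (gen_cosine j B T t (j b))
        + 8 *\<^sub>R B (gen_sine j T t (B (j b))) - 8 *\<^sub>R B (B (gen_sine j T t (j b)))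
        - 2 *\<^sub>R B (A (gen_sine j T t (j y)))"
    unfolding C'' Bv by (simp add: scaleR_diff_right scaleR_add_right)
  then show ?thesis
    using vector_derivative_gen_cosine_derivative[OF assms, of t]
      orbit(2)[OF Pair_mem_block_dom[OF assms], of t]
    by (simp add: C b w_def)
qed

lemma Ck_2_gen_cosine:
  assumes "j y \<in> domA"
  shows "Ck 2 (\<lambda>t. gen_cosine j B T t (j y))"
  unfolding numeral_2_eq_2 Ck.simps(2)[of "Suc 0"]
  by (rule exI[of _ "\<lambda>t. j (fst (T t (G (y, B (j y)))))"])
    (use has_vector_derivative_gen_cosine_domA[OF assms] Ck_Suc_0_fst_orbit in blast)

text \<open>The orbit through (x, Bx) is differentiable in the product norm, so its first component
  is differentiable in Y before \<open>j\<close> is applied.\<close>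

lemma Ck_into_1_gen_cosine:
  assumes "j y \<in> domA"
  shows "Ck_into 1 j (\<lambda>t. gen_cosine j B T t (j y))"
proof -
  have "Ck 1 (\<lambda>t. fst (T t (y, B (j y))))"
    unfolding One_nat_def Ck.simps
    by (rule exI[of _ "\<lambda>t. fst (T t (G (y, B (j y))))"])
      (use bounded_linear.has_vector_derivative[OF bounded_linear_fst
        orbit(3)[OF Pair_mem_block_dom[OF assms]]] continuous_fst_orbit in blast)
  then show ?thesis
    unfolding Ck_into_def gen_cosine_eq by (intro exI[of _ "\<lambda>t. fst (T t (y, B (j y)))"]) simp
qed

end

theorem lemma4p3:
  fixes j :: "'y::complex_banach \<Rightarrow> 'x::complex_banach"
    and domA domB :: "'x set"
    and A B :: "'x \<Rightarrow> 'x"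
    and T :: "real \<Rightarrow> 'y \<times> 'x \<Rightarrow> 'y \<times> 'x"
    and C S :: "real \<Rightarrow> 'x \<Rightarrow> 'x"
  assumes "closed_operator domA A"
    and "closed_operator domB B"
    and "resolvent_set domB B \<noteq> {}"
    and "continuous_embedding j"
    and "domA \<subseteq> dom_square domB B \<inter> range j"
    and "B ` domA \<subseteq> range j"
    and "range j \<subseteq> domB"
    and "generates_C0_group (block_dom j domA) (block_op j A B) T"
  defines "C \<equiv> gen_cosine j B T"
    and "S \<equiv> gen_sine j T"
  shows
    "(\<forall>y\<in>range j.
        Ck 1 (\<lambda>t. C t y) \<and> Ck_into 0 j (\<lambda>t. C t y) \<and>
        (\<forall>t. S t y \<in> domA \<and> C t y \<in> domB \<and> S t (B y) \<in> domB \<and>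
          (\<lambda>s. S s (B y)) differentiable (at t) \<and>
          ((\<lambda>s. C s y) has_vector_derivative
            A (S t y) - 2 *\<^sub>R B (C t y) + 4 *\<^sub>R B (S t (B y))
              + 2 *\<^sub>R vector_derivative (\<lambda>s. S s (B y)) (at t)) (at t)))
     \<and>
     (\<forall>x\<in>domA.
        Ck 2 (\<lambda>t. C t x) \<and> Ck_into 1 j (\<lambda>t. C t x) \<and>
        continuous_into_dom domA A (\<lambda>t. C t x) \<and>
        (\<forall>t. S t x \<in> domA \<and> A (S t x) \<in> domB \<and> C t x \<in> dom_square domB B \<and>
          S t (B x) \<in> dom_square domB B \<and> C t (B x) \<in> domB \<and> S t (B (B x)) \<in> domB \<and>
          ((\<lambda>s. C s x) has_vector_derivative
            A (S t x) - 2 *\<^sub>R B (C t x) + 4 *\<^sub>R B (S t (B x)) + 2 *\<^sub>R C t (B x)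
              - 4 *\<^sub>R S t (B (B x))) (at t) \<and>
          ((\<lambda>s. vector_derivative (\<lambda>r. C r x) (at s)) has_vector_derivative
            (A (C t x) + 4 *\<^sub>R B (B (C t x))) - 4 *\<^sub>R B (C t (B x)) + 8 *\<^sub>R B (S t (B (B x)))
              - 8 *\<^sub>R B (B (S t (B x))) - 2 *\<^sub>R B (A (S t x))) (at t)))"
proof -
  interpret block_group j domA domB A B T
    using assms by unfold_locales
  show ?thesis
    unfolding C_def S_def
  proof (intro conjI ballI)
    fix y assume "y \<in> range j"
    then obtain \<eta> where y: "y = j \<eta>" by auto
    show "Ck 1 (\<lambda>t. gen_cosine j B T t y)"
      using Ck_Suc_0_fst_orbit by (simp add: y gen_cosine_eq)
    show "Ck_into 0 j (\<lambda>t. gen_cosine j B T t y)"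
      unfolding Ck_into_def y gen_cosine_eq Ck.simps(1)
      by (rule exI[of _ "\<lambda>t. fst (T t (\<eta>, B (j \<eta>)))"]) (simp add: continuous_fst_orbit)
    show "\<forall>t. gen_sine j T t y \<in> domA \<and> gen_cosine j B T t y \<in> domB \<and> gen_sine j T t (B y) \<in> domB \<and>
        (\<lambda>s. gen_sine j T s (B y)) differentiable (at t) \<and>
        ((\<lambda>s. gen_cosine j B T s y) has_vector_derivative
          A (gen_sine j T t y) - 2 *\<^sub>R B (gen_cosine j B T t y) + 4 *\<^sub>R B (gen_sine j T t (B y))
            + 2 *\<^sub>R vector_derivative (\<lambda>s. gen_sine j T s (B y)) (at t)) (at t)"
      using gen_sine_derivative[THEN differentiableI_vector] gen_sine_domA gen_cosine_derivative
      by (simp add: y vector_derivative_at[OF gen_sine_derivative] gen_cosine_eq)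
        (simp add: gen_sine_def)
  next
    fix x assume x: "x \<in> domA"
    then obtain \<xi> where \<xi>: "x = j \<xi>" "j \<xi> \<in> domA"
      using domA by auto
    \<comment> \<open>Since Bx lies in Y, the facts on Y apply to \<open>b\<close>: S(t)Bx is in
      \<open>domA\<close>, hence in \<open>dom_square domB B\<close>, and C(t)Bx is in
      \<open>range j\<close>.\<close>
    obtain b where b: "B (j \<xi>) = j b"
      using B_j_mem_range[OF \<xi>(2)] by auto
    show "Ck 2 (\<lambda>t. gen_cosine j B T t x)" "Ck_into 1 j (\<lambda>t. gen_cosine j B T t x)"
      "continuous_into_dom domA A (\<lambda>t. gen_cosine j B T t x)"
      unfolding \<xi>(1)
      using Ck_2_gen_cosine Ck_into_1_gen_cosine continuous_into_domA_gen_cosine \<xi>(2) by blast+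
    have "gen_cosine j B T t x \<in> dom_square domB B" "gen_sine j T t (B x) \<in> dom_square domB B"
      "gen_cosine j B T t (B x) \<in> domB" "gen_sine j T t (B (B x)) \<in> domB" for t
      using gen_cosine_domA(1)[OF \<xi>(2)] gen_sine_domA[of t b] domA
      by (auto simp: \<xi>(1) b gen_cosine_eq) (simp_all add: gen_sine_def)
    then show "\<forall>t. gen_sine j T t x \<in> domA \<and> A (gen_sine j T t x) \<in> domB \<and> gen_cosine j B T t x \<in> dom_square domB B \<and>
          gen_sine j T t (B x) \<in> dom_square domB B \<and> gen_cosine j B T t (B x) \<in> domB \<and> gen_sine j T t (B (B x)) \<in> domB \<and>
          ((\<lambda>s. gen_cosine j B T s x) has_vector_derivative
            A (gen_sine j T t x) - 2 *\<^sub>R B (gen_cosine j B T t x) + 4 *\<^sub>R B (gen_sine j T t (B x)) + 2 *\<^sub>R gen_cosine j B T t (B x)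
              - 4 *\<^sub>R gen_sine j T t (B (B x))) (at t) \<and>
          ((\<lambda>s. vector_derivative (\<lambda>r. gen_cosine j B T r x) (at s)) has_vector_derivative
            (A (gen_cosine j B T t x) + 4 *\<^sub>R B (B (gen_cosine j B T t x))) - 4 *\<^sub>R B (gen_cosine j B T t (B x)) + 8 *\<^sub>R B (gen_sine j T t (B (B x)))
              - 8 *\<^sub>R B (B (gen_sine j T t (B x))) - 2 *\<^sub>R B (A (gen_sine j T t x))) (at t)"
      unfolding \<xi>(1)
      using gen_sine_domA A_gen_sine_domB[OF \<xi>(2)] gen_cosine_derivative_domA
        gen_cosine_second_derivative[OF \<xi>(2)]
      by blast
  qed
qed

end
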